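(* Let $a,b,c\in\mathbb{C}$ and consider the linear system $\dot{x}=y$, $\dot{y}=2(a+b)y-(a^2+c+b^2)x$. Put $\rho=2ab-c$. Let $K=\mathbb{C}$ with the trivial derivation, and let $L/K$ be the Picard-Vessiot extension of the associated reduced second order equation $\ddot{y}=\rho y$. Then: (i) If $2ab-c=0$, then the differential Galois group is $\mathrm{DGal}(L/K)=\left(\{\sigma_\mu : \sigma_\mu(y)=y+\mu,\ \mu\in\mathbb{C}\},\circ\right)$, where $y=t$ is the non-constant basis solution, so that $L=\mathbb{C}(t)$. In other words, the group is the additive group $\mathbb{G}_a$. (ii) If $2ab-c\neq 0$, then the differential Galois group is $\mathrm{DGal}(L/K)=\left(\{\sigma_\mu : \sigma_\mu(y)=\mu y,\ \mu\in\mathbb{C}\setminus\{0\}\},\circ\right)$, where $y=e^{\sqrt{\rho}\,t}$, so that $L=\mathbb{C}(e^{\sqrt{\rho}\,t})$. In other words, the group is the multiplicative group $\mathbb{G}_m$.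
   Context: Eliminating $y$ from the system gives the second order equation $\ddot{x}-2(a+b)\dot{x}+(a^2+c+b^2)x=0$. The change of variable $x=e^{(a+b)t}y$ transforms it into the reduced equation $\ddot{y}=\rho y$ with $\rho=2ab-c$, where the dot denotes $d/dt$. The differential Galois group considered is that of the reduced equation over the constant field $K=\mathbb{C}$. $\mathrm{DGal}(L/K)$ denotes the group, under composition, of field automorphisms of $L$ that commute with the derivation $d/dt$ and fix $K$ pointwise. $\sqrt{\rho}$ is a fixed square root of $\rho$ in $\mathbb{C}$. *)

theory Defs
  imports
    "HOL-Analysis.Analysis"
    "HOL-Algebra.Algebra"
    "HOL-Computational_Algebra.Computational_Algebra"
    "HOL-Algebra.Algebraic_Closure_Type"
begin

section \<open>The linear system and its reduced equation\<close>

text \<open>The dot is the complex derivative with respect to the time t; solutions are entire.\<close>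

definition system_solution ::
  "complex \<Rightarrow> complex \<Rightarrow> complex \<Rightarrow> (complex \<Rightarrow> complex) \<Rightarrow> (complex \<Rightarrow> complex) \<Rightarrow> bool" where
  "system_solution a b c x y \<longleftrightarrow>
     (\<forall>t. (x has_field_derivative y t) (at t)) \<and>
     (\<forall>t. (y has_field_derivative 2 * (a + b) * y t - (a^2 + c + b^2) * x t) (at t))"

definition reduced_solution :: "complex \<Rightarrow> (complex \<Rightarrow> complex) \<Rightarrow> bool" where
  "reduced_solution \<rho> u \<longleftrightarrow>
     (\<exists>v. (\<forall>t. (u has_field_derivative v t) (at t)) \<and>
          (\<forall>t. (v has_field_derivative \<rho> * u t) (at t)))"


section \<open>Differential fields\<close>

definition differential_field :: "('a, 'm) ring_scheme \<Rightarrow> ('a \<Rightarrow> 'a) \<Rightarrow> bool" where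
  "differential_field F D \<longleftrightarrow>
     Ring.field F \<and> D \<in> carrier F \<rightarrow> carrier F \<and>
     (\<forall>x\<in>carrier F. \<forall>y\<in>carrier F. D (x \<oplus>\<^bsub>F\<^esub> y) = D x \<oplus>\<^bsub>F\<^esub> D y) \<and>
     (\<forall>x\<in>carrier F. \<forall>y\<in>carrier F. D (x \<otimes>\<^bsub>F\<^esub> y) = (D x \<otimes>\<^bsub>F\<^esub> y) \<oplus>\<^bsub>F\<^esub> (x \<otimes>\<^bsub>F\<^esub> D y))"

definition constants :: "('a, 'm) ring_scheme \<Rightarrow> ('a \<Rightarrow> 'a) \<Rightarrow> 'a set" where
  "constants F D = {x \<in> carrier F. D x = \<zero>\<^bsub>F\<^esub>}"

text \<open>The base field is embedded into the extension by a map \<open>\<iota>\<close>, not assumed to be a subset of it.\<close>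

definition differential_extension ::
  "('k, 'n) ring_scheme \<Rightarrow> ('k \<Rightarrow> 'k) \<Rightarrow> ('a, 'm) ring_scheme \<Rightarrow> ('a \<Rightarrow> 'a) \<Rightarrow> ('k \<Rightarrow> 'a) \<Rightarrow> bool" where
  "differential_extension K \<delta> L D \<iota> \<longleftrightarrow>
     differential_field K \<delta> \<and> differential_field L D \<and> \<iota> \<in> ring_hom K L \<and>
     (\<forall>z\<in>carrier K. D (\<iota> z) = \<iota> (\<delta> z))"

definition differentially_generated ::
  "('a, 'm) ring_scheme \<Rightarrow> ('a \<Rightarrow> 'a) \<Rightarrow> 'a set \<Rightarrow> bool" where
  "differentially_generated L D S \<longleftrightarrow>
     (\<forall>M. subfield M L \<and> D ` M \<subseteq> M \<and> S \<subseteq> M \<longrightarrow> M = carrier L)"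

text \<open>
  Picard-Vessiot extension for the equation \<open>y'' = \<rho> y\<close> with \<open>\<rho>\<close> in K: there are two solutions that
  are linearly independent over the constants, L is generated by them over K as a differential
  field, and there are no new constants.
\<close>

definition picard_vessiot ::
  "('k, 'n) ring_scheme \<Rightarrow> ('k \<Rightarrow> 'k) \<Rightarrow> ('a, 'm) ring_scheme \<Rightarrow> ('a \<Rightarrow> 'a) \<Rightarrow> ('k \<Rightarrow> 'a) \<Rightarrow> 'k \<Rightarrow> bool" where
  "picard_vessiot K \<delta> L D \<iota> \<rho> \<longleftrightarrow>
     differential_extension K \<delta> L D \<iota> \<and>
     constants L D = \<iota> ` constants K \<delta> \<and>
     (\<exists>y1\<in>carrier L. \<exists>y2\<in>carrier L.
        D (D y1) = \<iota> \<rho> \<otimes>\<^bsub>L\<^esub> y1 \<and> D (D y2) = \<iota> \<rho> \<otimes>\<^bsub>L\<^esub> y2 \<and>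
        (\<forall>c1\<in>constants L D. \<forall>c2\<in>constants L D.
           (c1 \<otimes>\<^bsub>L\<^esub> y1) \<oplus>\<^bsub>L\<^esub> (c2 \<otimes>\<^bsub>L\<^esub> y2) = \<zero>\<^bsub>L\<^esub> \<longrightarrow> c1 = \<zero>\<^bsub>L\<^esub> \<and> c2 = \<zero>\<^bsub>L\<^esub>) \<and>
        differentially_generated L D (\<iota> ` carrier K \<union> {y1, y2}))"

text \<open>
  As in \<^const>\<open>AutoGroup\<close>, automorphisms are extensional functions on the carrier and the group
  operation is composition.
\<close>

definition DGal ::
  "('k, 'n) ring_scheme \<Rightarrow> ('a, 'm) ring_scheme \<Rightarrow> ('a \<Rightarrow> 'a) \<Rightarrow> ('k \<Rightarrow> 'a) \<Rightarrow> ('a \<Rightarrow> 'a) monoid" where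
  "DGal K L D \<iota> = BijGroup (carrier L)
     \<lparr>carrier := {\<sigma> \<in> ring_hom L L \<inter> Bij (carrier L).
        (\<forall>x\<in>carrier L. \<sigma> (D x) = D (\<sigma> x)) \<and> (\<forall>z\<in>carrier K. \<sigma> (\<iota> z) = \<iota> z)}\<rparr>"

definition simple_extension ::
  "('k, 'n) ring_scheme \<Rightarrow> ('a, 'm) ring_scheme \<Rightarrow> ('k \<Rightarrow> 'a) \<Rightarrow> 'a \<Rightarrow> 'a set" where
  "simple_extension K L \<iota> y = generate_field L (insert y (\<iota> ` carrier K))"


section \<open>Function fields as Laurent series\<close>

abbreviation complex_field :: "complex ring" where
  "complex_field \<equiv> ring_of_type_algebra"

text \<open>
  Meromorphic functions of t are represented by their Laurent series at 0: t is \<^const>\<open>fls_X\<close>,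
  \<open>e\<^sup>s\<^sup>t\<close> is \<^term>\<open>fps_to_fls (fps_exp s)\<close>, d/dt is \<^const>\<open>fls_deriv\<close>, and
  \<^term>\<open>complex_functions f\<close> is the field \<open>\<complex>(f)\<close>.
\<close>

definition complex_functions :: "complex fls \<Rightarrow> complex fls ring" where
  "complex_functions f = ring_of_type_algebra
     \<lparr>carrier := simple_extension complex_field ring_of_type_algebra fls_const f\<rparr>"

end

theory Submission
  imports Defs
begin

text \<open>
  In a differential extension L of a constant field K of characteristic 0 without new constants,
  every y with \<open>D y \<noteq> 0\<close> is transcendental over K: if \<open>p(y) = 0\<close> then \<open>p'(y) D y = 0\<close>, so
  the degree of p could be lowered. Suitable combinations of the two generating solutions satisfy
  first order equations, which yields y with \<open>D y = 1\<close> or \<open>D y = s y\<close>; a second solution of the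
  same first order equation differs from y by an additive, respectively multiplicative, constant.
  Hence \<open>L = K(y)\<close> is a rational function field, an automorphism is determined by the image of y,
  and conversely every admissible image extends to an automorphism by substitution.
\<close>

section \<open>Fractions in a field\<close>

lemma (in Ring.field) inv_props:
  assumes "x \<in> carrier R" "x \<noteq> \<zero>"
  shows "inv x \<in> carrier R" "inv x \<noteq> \<zero>" "x \<otimes> inv x = \<one>" "inv x \<otimes> x = \<one>" "inv (inv x) = x"
proof -
  have u: "x \<in> Units R" using assms by (simp add: field_Units)
  show "inv x \<in> carrier R" "x \<otimes> inv x = \<one>" "inv x \<otimes> x = \<one>" "inv (inv x) = x"
    using u by auto
  show "inv x \<noteq> \<zero>" using \<open>inv x \<otimes> x = \<one>\<close> assms(1) by auto
qed

lemma (in Ring.field) inv_mult_units: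
  assumes "x \<in> carrier R" "y \<in> carrier R" "x \<noteq> \<zero>" "y \<noteq> \<zero>"
  shows "inv (x \<otimes> y) = inv x \<otimes> inv y"
proof (rule comm_inv_char)
  have "(x \<otimes> y) \<otimes> (inv x \<otimes> inv y) = (x \<otimes> inv x) \<otimes> (y \<otimes> inv y)"
    using assms(1,2) inv_props(1)[OF assms(1,3)] inv_props(1)[OF assms(2,4)] by (simp add: m_ac)
  thus "(x \<otimes> y) \<otimes> (inv x \<otimes> inv y) = \<one>"
    using inv_props(3)[OF assms(1,3)] inv_props(3)[OF assms(2,4)] by simp
qed (use assms inv_props(1) in auto)

lemma (in Ring.field) frac_eq_iff:
  assumes "a \<in> carrier R" "b \<in> carrier R" "c \<in> carrier R" "d \<in> carrier R" "b \<noteq> \<zero>" "d \<noteq> \<zero>"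
  shows "a \<otimes> inv b = c \<otimes> inv d \<longleftrightarrow> a \<otimes> d = c \<otimes> b"
proof -
  note i = inv_props[OF assms(2,5)] inv_props[OF assms(4,6)]
  have "(a \<otimes> inv b) \<otimes> (b \<otimes> d) = a \<otimes> (inv b \<otimes> b) \<otimes> d"
    using assms i(1) by (simp add: m_ac)
  hence 1: "(a \<otimes> inv b) \<otimes> (b \<otimes> d) = a \<otimes> d" using assms i by simp
  have "(c \<otimes> inv d) \<otimes> (b \<otimes> d) = c \<otimes> (inv d \<otimes> d) \<otimes> b"
    using assms i(1,2,6,7) by (simp add: m_ac)
  hence 2: "(c \<otimes> inv d) \<otimes> (b \<otimes> d) = c \<otimes> b" using assms i by simp
  have "b \<otimes> d \<noteq> \<zero>" using assms integral by blast
  hence "a \<otimes> inv b = c \<otimes> inv d \<longleftrightarrow> (a \<otimes> inv b) \<otimes> (b \<otimes> d) = (c \<otimes> inv d) \<otimes> (b \<otimes> d)"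
    using assms i m_rcancel by simp
  thus ?thesis using 1 2 by simp
qed

lemma (in Ring.field) frac_mult:
  assumes "a \<in> carrier R" "b \<in> carrier R" "c \<in> carrier R" "d \<in> carrier R" "b \<noteq> \<zero>" "d \<noteq> \<zero>"
  shows "(a \<otimes> inv b) \<otimes> (c \<otimes> inv d) = (a \<otimes> c) \<otimes> inv (b \<otimes> d)"
proof -
  have "inv (b \<otimes> d) = inv b \<otimes> inv d"
    using assms by (intro inv_mult_units)
  thus ?thesis using assms inv_props(1)[of b] inv_props(1)[of d] by (simp add: m_ac)
qed

lemma (in Ring.field) frac_add:
  assumes "a \<in> carrier R" "b \<in> carrier R" "c \<in> carrier R" "d \<in> carrier R" "b \<noteq> \<zero>" "d \<noteq> \<zero>"
  shows "(a \<otimes> inv b) \<oplus> (c \<otimes> inv d) = (a \<otimes> d \<oplus> c \<otimes> b) \<otimes> inv (b \<otimes> d)"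
proof -
  have nz: "b \<otimes> d \<noteq> \<zero>" using assms integral by blast
  have "a \<otimes> inv b = (a \<otimes> d) \<otimes> inv (b \<otimes> d)" "c \<otimes> inv d = (c \<otimes> b) \<otimes> inv (b \<otimes> d)"
    using assms nz by (auto simp: frac_eq_iff m_ac)
  thus ?thesis using assms nz inv_props(1)[of "b \<otimes> d"] by (simp add: l_distr)
qed

lemma (in Ring.field) inv_frac:
  assumes "a \<in> carrier R" "b \<in> carrier R" "a \<noteq> \<zero>" "b \<noteq> \<zero>"
  shows "inv (a \<otimes> inv b) = b \<otimes> inv a"
proof -
  have "inv (a \<otimes> inv b) = inv a \<otimes> inv (inv b)"
    using assms inv_props[of b] by (intro inv_mult_units) auto
  thus ?thesis using assms inv_props[of a] inv_props[of b] by (simp add: m_comm)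
qed

lemma ring_of_type_algebra_simps [simp]:
  "carrier ring_of_type_algebra = UNIV" "\<one>\<^bsub>ring_of_type_algebra\<^esub> = 1"
  "\<zero>\<^bsub>ring_of_type_algebra\<^esub> = 0"
  "x \<otimes>\<^bsub>ring_of_type_algebra\<^esub> y = x * y" "x \<oplus>\<^bsub>ring_of_type_algebra\<^esub> y = x + y"
  by (simp_all add: ring_of_type_algebra_def)

section \<open>Differential fields over a field of constants\<close>

text \<open>The base field is a type of class \<open>field_char_0\<close>, so
  \<open>'k poly\<close>, \<open>degree\<close> and \<open>pderiv\<close> are available for
  polynomials over it. \<open>constant_iff\<close> says at once that K has trivial derivation and
  that L has no new constants.\<close>

locale constant_differential_field = Ring.field L
  for L :: "('l, 'm) ring_scheme" (structure) +
  fixes D :: "'l \<Rightarrow> 'l" and \<iota> :: "'k :: field_char_0 \<Rightarrow> 'l"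
  assumes D_closed [simp]: "x \<in> carrier L \<Longrightarrow> D x \<in> carrier L"
    and D_add: "x \<in> carrier L \<Longrightarrow> y \<in> carrier L \<Longrightarrow> D (x \<oplus> y) = D x \<oplus> D y"
    and D_mult: "x \<in> carrier L \<Longrightarrow> y \<in> carrier L \<Longrightarrow> D (x \<otimes> y) = D x \<otimes> y \<oplus> x \<otimes> D y"
    and \<iota>_hom: "\<iota> \<in> ring_hom ring_of_type_algebra L"
    and constant_iff: "x \<in> carrier L \<Longrightarrow> D x = \<zero> \<longleftrightarrow> x \<in> range \<iota>"
begin

section \<open>Elementary rules for the embedding and the derivation\<close>

lemma \<iota>_closed [simp]: "\<iota> z \<in> carrier L"
  using ring_hom_closed[OF \<iota>_hom] by simp

lemma \<iota>_add: "\<iota> (z + w) = \<iota> z \<oplus> \<iota> w"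
  using ring_hom_add[OF \<iota>_hom] by simp

lemma \<iota>_mult: "\<iota> (z * w) = \<iota> z \<otimes> \<iota> w"
  using ring_hom_mult[OF \<iota>_hom] by simp

lemma \<iota>_1 [simp]: "\<iota> 1 = \<one>"
  using ring_hom_one[OF \<iota>_hom] by simp

lemma \<iota>_0 [simp]: "\<iota> 0 = \<zero>"
  using \<iota>_add[of 0 0] by (metis add.l_cancel_one' add_0 \<iota>_closed)

lemma \<iota>_minus: "\<iota> (- z) = \<ominus> \<iota> z"
  using \<iota>_add[of "-z" z] by (metis \<iota>_0 \<iota>_closed add.left_inverse add.inv_equality)

lemma \<iota>_eq_0_iff [simp]: "\<iota> z = \<zero> \<longleftrightarrow> z = 0"
proof
  assume *: "\<iota> z = \<zero>"
  show "z = 0"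
  proof (rule ccontr)
    assume "z \<noteq> 0"
    hence "\<one> = \<iota> z \<otimes> \<iota> (inverse z)" by (metis \<iota>_1 \<iota>_mult right_inverse)
    with * show False by simp
  qed
qed simp

lemma \<iota>_inj: "\<iota> z = \<iota> w \<Longrightarrow> z = w"
  by (metis \<iota>_add \<iota>_closed \<iota>_eq_0_iff \<iota>_minus add.right_inverse eq_iff_diff_eq_0 r_neg diff_conv_add_uminus)

lemma D_\<iota> [simp]: "D (\<iota> z) = \<zero>"
  using constant_iff by simp

lemma D_zero [simp]: "D \<zero> = \<zero>" and D_one [simp]: "D \<one> = \<zero>"
  using D_\<iota>[of 0] D_\<iota>[of 1] by simp_all

lemma D_minus:
  assumes "x \<in> carrier L"
  shows "D (\<ominus> x) = \<ominus> D x"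
proof -
  have "D (\<ominus> x) \<oplus> D x = \<zero>" using D_add[of "\<ominus> x" x] assms by (simp add: l_neg)
  thus ?thesis using assms by (simp add: minus_equality)
qed

text \<open>Differentiate \<open>x \<otimes> inv x = \<one>\<close>, multiply by
  \<open>inv x\<close> and solve for the derivative of \<open>inv x\<close>.\<close>

lemma D_inv:
  assumes "x \<in> carrier L" "x \<noteq> \<zero>"
  shows "D (inv x) = \<ominus> (D x \<otimes> inv x \<otimes> inv x)"
proof -
  note i = inv_props[OF assms]
  have "\<zero> = D (x \<otimes> inv x)" using i by simp
  also have "\<dots> = D x \<otimes> inv x \<oplus> x \<otimes> D (inv x)" by (rule D_mult[OF assms(1) i(1)])
  finally have "(D x \<otimes> inv x \<oplus> x \<otimes> D (inv x)) \<otimes> inv x = \<zero>"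
    using i(1) by (metis l_null)
  moreover have "(D x \<otimes> inv x \<oplus> x \<otimes> D (inv x)) \<otimes> inv x
      = D x \<otimes> inv x \<otimes> inv x \<oplus> D (inv x) \<otimes> (x \<otimes> inv x)"
    using assms i(1) by (simp add: l_distr r_distr m_ac)
  ultimately have "D (inv x) \<oplus> D x \<otimes> inv x \<otimes> inv x = \<zero>"
    using assms i(1,3) by (simp add: a_comm)
  thus ?thesis using assms i(1) by (simp add: minus_equality)
qed

lemma D_\<iota>_mult: "x \<in> carrier L \<Longrightarrow> D (\<iota> z \<otimes> x) = \<iota> z \<otimes> D x"
  by (simp add: D_mult)


section \<open>Evaluation of polynomials over the constants\<close>

text \<open>The Horner scheme, with coefficients carried into L by \<open>\<iota>\<close>.\<close>

definition ev :: "'l \<Rightarrow> 'k poly \<Rightarrow> 'l" where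
  "ev y p = fold_coeffs (\<lambda>a r. \<iota> a \<oplus> y \<otimes> r) p \<zero>"

lemma ev_0 [simp]: "ev y 0 = \<zero>"
  by (simp add: ev_def)

lemma ev_pCons [simp]: "y \<in> carrier L \<Longrightarrow> ev y (pCons a p) = \<iota> a \<oplus> y \<otimes> ev y p"
  by (cases "p = 0 \<and> a = 0") (auto simp: ev_def)

lemma ev_closed [simp]: "y \<in> carrier L \<Longrightarrow> ev y p \<in> carrier L"
  by (induction p) auto

lemma ev_1 [simp]: "y \<in> carrier L \<Longrightarrow> ev y 1 = \<one>"
  by (simp add: one_pCons)

lemma ev_add:
  assumes "y \<in> carrier L"
  shows "ev y (p + q) = ev y p \<oplus> ev y q"
proof (induction p q rule: poly_induct2)
  case (pCons a p b q)
  thus ?case using assms by (simp add: \<iota>_add r_distr a_ac)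
qed simp

lemma ev_smult:
  assumes "y \<in> carrier L"
  shows "ev y (Polynomial.smult c p) = \<iota> c \<otimes> ev y p"
  by (induction p) (use assms in \<open>auto simp: \<iota>_mult r_distr m_ac\<close>)

lemma ev_mult:
  assumes "y \<in> carrier L"
  shows "ev y (p * q) = ev y p \<otimes> ev y q"
  by (induction p) (use assms in \<open>auto simp: ev_add ev_smult l_distr r_distr m_ac\<close>)

lemma ev_minus:
  assumes "y \<in> carrier L"
  shows "ev y (- p) = \<ominus> ev y p"
  using ev_smult[OF assms, of "-1" p] assms by (simp add: \<iota>_minus l_minus)

text \<open>The chain rule: the coefficients are constants, so only the powers of y
  contribute.\<close>

lemma D_ev:
  assumes "y \<in> carrier L"
  shows "D (ev y p) = ev y (pderiv p) \<otimes> D y"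
proof (induction p)
  case (pCons a p)
  thus ?case using assms
    by (simp add: pderiv_pCons ev_add D_add D_mult l_distr r_distr m_ac)
qed (use assms in simp)

text \<open>Nonconstant elements are transcendental. A relation \<open>ev y p = \<zero>\<close>
  differentiates to one for \<open>pderiv p\<close>, since \<open>D y\<close> can be cancelled, and
  the degree drops.\<close>

lemma ev_eq_0_iff:
  assumes y: "y \<in> carrier L" and Dy: "D y \<noteq> \<zero>"
  shows "ev y p = \<zero> \<longleftrightarrow> p = 0"
proof
  assume "ev y p = \<zero>"
  thus "p = 0"
  proof (induction "Polynomial.degree p" arbitrary: p rule: less_induct)
    case less
    have "ev y (pderiv p) = \<zero>"
      using D_ev[OF y, of p] less.prems y Dy integral[of "ev y (pderiv p)" "D y"] by simp
    hence *: "pderiv p = 0" if "Polynomial.degree p \<noteq> 0"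
      using less.hyps[of "pderiv p"] that by (simp add: degree_pderiv)
    \<comment> \<open>In characteristic zero \<open>pderiv p = 0\<close> itself forces degree zero,
      so the other case is contradictory.\<close>
    hence "Polynomial.degree p = 0" by (metis pderiv_eq_0_iff)
    then obtain a where "p = [:a:]" by (rule degree_eq_zeroE)
    thus ?case using less.prems y by simp
  qed
qed simp


section \<open>The subfield K(y)\<close>

abbreviation gen :: "'l \<Rightarrow> 'l set" where
  "gen y \<equiv> generate_field L (insert y (range \<iota>))"

lemma gen_closed: "y \<in> carrier L \<Longrightarrow> x \<in> gen y \<Longrightarrow> x \<in> carrier L"
  by (rule generate_field_in_carrier) auto

text \<open>The derivation sends the generators into \<open>gen y\<close>, and the sum, product and
  quotient rules propagate this. Hence field generation by y is already differential
  generation.\<close>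

lemma gen_D_closed:
  assumes y: "y \<in> carrier L" and Dy: "D y \<in> gen y" and "x \<in> gen y"
  shows "D x \<in> gen y"
  using assms(3)
proof (induction rule: generate_field.induct)
  case one
  show ?case using zero_in_generate by simp
next
  case (incl h)
  thus ?case using Dy zero_in_generate by auto
next
  case (a_inv h)
  thus ?case using y by (auto simp: D_minus gen_closed intro!: generate_field.eng_add generate_field.a_inv)
next
  case (m_inv h)
  thus ?case using y by (auto simp: D_inv gen_closed intro!: generate_field.eng_add generate_field.eng_mult generate_field.a_inv generate_field.m_inv)
next
  case (eng_add h1 h2)
  thus ?case using y by (auto simp: D_add gen_closed intro!: generate_field.eng_add generate_field.a_inv)
next
  case (eng_mult h1 h2)
  thus ?case using y by (auto simp: D_mult gen_closed intro!: generate_field.eng_add generate_field.eng_mult generate_field.a_inv generate_field.m_inv)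
qed

section \<open>Rational functions of a nonconstant element\<close>

text \<open>Numerator and denominator are separate arguments, so that one formal fraction can be
  evaluated at different elements.\<close>

definition fr :: "'l \<Rightarrow> 'k poly \<Rightarrow> 'k poly \<Rightarrow> 'l" where
  "fr y p q = ev y p \<otimes> inv (ev y q)"

context
  fixes y assumes y: "y \<in> carrier L" and Dy: "D y \<noteq> \<zero>"
begin

lemma fr_closed: "q \<noteq> 0 \<Longrightarrow> fr y p q \<in> carrier L"
  using y Dy inv_props(1)[of "ev y q"] by (simp add: fr_def ev_eq_0_iff)

text \<open>By transcendence, equality of two values is a polynomial identity that no longer
  mentions y. It therefore transfers from one nonconstant element to another.\<close>

lemma fr_eq_iff: "q \<noteq> 0 \<Longrightarrow> q' \<noteq> 0 \<Longrightarrow> fr y p q = fr y p' q' \<longleftrightarrow> p * q' = p' * q"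
proof -
  assume q: "q \<noteq> 0" "q' \<noteq> 0"
  have "fr y p q = fr y p' q' \<longleftrightarrow> ev y (p * q') = ev y (p' * q)"
    using q y Dy unfolding fr_def by (subst frac_eq_iff) (auto simp: ev_eq_0_iff ev_mult)
  also have "\<dots> \<longleftrightarrow> ev y (p * q' + - (p' * q)) = \<zero>"
    using y unfolding ev_add[OF y] ev_minus[OF y]
    by (metis a_minus_def ev_closed r_right_minus_eq)
  also have "\<dots> \<longleftrightarrow> p * q' = p' * q"
    by (simp add: ev_eq_0_iff[OF y Dy])
  finally show ?thesis .
qed

lemma fr_add: "q \<noteq> 0 \<Longrightarrow> q' \<noteq> 0 \<Longrightarrow> fr y p q \<oplus> fr y p' q' = fr y (p * q' + p' * q) (q * q')"
  using y Dy by (simp add: fr_def frac_add ev_eq_0_iff ev_add ev_mult)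

lemma fr_mult: "q \<noteq> 0 \<Longrightarrow> q' \<noteq> 0 \<Longrightarrow> fr y p q \<otimes> fr y p' q' = fr y (p * p') (q * q')"
  using y Dy by (simp add: fr_def frac_mult ev_eq_0_iff ev_mult)

lemma fr_1: "fr y p 1 = ev y p"
  using y by (simp add: fr_def)

text \<open>Values of fractions include the generators and are closed under the field operations; a
  nonzero value has a nonzero numerator, so its fraction can be inverted.\<close>

lemma gen_fr:
  assumes "x \<in> gen y"
  obtains p q where "q \<noteq> 0" "x = fr y p q"
proof -
  from assms have "\<exists>p q. q \<noteq> 0 \<and> x = fr y p q"
  proof (induction rule: generate_field.induct)
    case one
    show ?case using y by (intro exI[of _ 1]) (simp add: fr_1)
  next
    case (incl h)
    then consider "h = y" | z where "h = \<iota> z" by auto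
    then obtain p where "h = ev y p"
    proof cases
      case 1
      thus thesis using y by (intro that[of "[:0, 1:]"]) simp
    next
      case (2 z)
      thus thesis using y by (intro that[of "[:z:]"]) simp
    qed
    thus ?case using fr_1 by (intro exI[of _ p] exI[of _ 1]) simp
  next
    case (a_inv h)
    then obtain p q where "q \<noteq> 0" "h = fr y p q" by blast
    thus ?case using y Dy inv_props(1)[of "ev y q"]
      by (intro exI[of _ "- p"] exI[of _ q]) (simp add: fr_def ev_minus l_minus ev_eq_0_iff)
  next
    case (m_inv h)
    then obtain p q where pq: "q \<noteq> 0" "h = fr y p q" by blast
    with m_inv.hyps have "p \<noteq> 0" using y Dy inv_props(1)[of "ev y q"]
      by (auto simp: fr_def ev_eq_0_iff)
    thus ?case using pq y Dy
      by (intro exI[of _ q] exI[of _ p]) (simp add: fr_def inv_frac ev_eq_0_iff)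
  next
    case (eng_add h1 h2)
    thus ?case by (metis fr_add no_zero_divisors)
  next
    case (eng_mult h1 h2)
    thus ?case by (metis fr_mult no_zero_divisors)
  qed
  thus ?thesis using that by blast
qed

end


section \<open>Differential automorphisms\<close>

abbreviation Gal :: "('l \<Rightarrow> 'l) monoid" where
  "Gal \<equiv> DGal (ring_of_type_algebra :: 'k ring) L D \<iota>"

lemma carrier_Gal: "carrier Gal = {\<phi> \<in> ring_hom L L \<inter> Bij (carrier L).
    (\<forall>x\<in>carrier L. \<phi> (D x) = D (\<phi> x)) \<and> (\<forall>z. \<phi> (\<iota> z) = \<iota> z)}"
  by (simp add: DGal_def)

lemma mult_Gal:
  assumes "\<phi> \<in> carrier Gal" "\<psi> \<in> carrier Gal"
  shows "\<phi> \<otimes>\<^bsub>Gal\<^esub> \<psi> = compose (carrier L) \<phi> \<psi>"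
  using assms by (simp add: carrier_Gal) (simp add: DGal_def BijGroup_def)

lemma hom_ev:
  assumes \<phi>: "\<phi> \<in> ring_hom L L" "\<And>z. \<phi> (\<iota> z) = \<iota> z" and y: "y \<in> carrier L"
  shows "\<phi> (ev y p) = ev (\<phi> y) p"
proof (induction p)
  case 0
  show ?case using \<phi>(2)[of 0] by simp
next
  case (pCons a p)
  thus ?case using y \<phi>(2) ring_hom_closed[OF \<phi>(1)]
    by (simp add: ring_hom_add[OF \<phi>(1)] ring_hom_mult[OF \<phi>(1)])
qed

lemma hom_inv:
  assumes \<phi>: "\<phi> \<in> ring_hom L L" and x: "x \<in> carrier L" "x \<noteq> \<zero>"
  shows "\<phi> (inv x) = inv (\<phi> x)"
proof -
  have "\<phi> x \<otimes> \<phi> (inv x) = \<one>"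
    using inv_props[OF x] x ring_hom_mult[OF \<phi>] ring_hom_one[OF \<phi>] by metis
  thus ?thesis using ring_hom_closed[OF \<phi>] inv_props(1)[OF x] x comm_inv_char by metis
qed

lemma hom_fr:
  assumes "\<phi> \<in> ring_hom L L" "\<And>z. \<phi> (\<iota> z) = \<iota> z" "y \<in> carrier L" "D y \<noteq> \<zero>" "q \<noteq> 0"
  shows "\<phi> (fr y p q) = fr (\<phi> y) p q"
  using assms inv_props(1)[of "ev y q"]
  by (simp add: fr_def ring_hom_mult hom_inv hom_ev ev_eq_0_iff)

text \<open>Every element is a fraction in y with fixed coefficients, so the image of y determines
  an automorphism on the carrier; extensionality settles the rest.\<close>

lemma Gal_eqI:
  assumes y: "y \<in> carrier L" "D y \<noteq> \<zero>" "carrier L = gen y"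
    and \<phi>: "\<phi> \<in> carrier Gal" and \<psi>: "\<psi> \<in> carrier Gal" and eq: "\<phi> y = \<psi> y"
  shows "\<phi> = \<psi>"
proof (rule extensionalityI[of _ "carrier L"])
  show "\<phi> \<in> extensional (carrier L)" "\<psi> \<in> extensional (carrier L)"
    using \<phi> \<psi> by (auto simp: carrier_Gal Bij_def)
next
  fix x assume "x \<in> carrier L"
  then obtain p q where "q \<noteq> 0" "x = fr y p q" using gen_fr y by metis
  thus "\<phi> x = \<psi> x" using \<phi> \<psi> y eq by (simp add: carrier_Gal hom_fr)
qed

text \<open>The quotient rule, left as two summands. The fractions on the right depend only on p, q
  and F, so the formula looks the same at every solution of \<open>D y = ev y F\<close>.\<close>

lemma D_fr:
  assumes y: "y \<in> carrier L" "D y \<noteq> \<zero>" and F: "D y = ev y F" and q: "q \<noteq> 0"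
  shows "D (fr y p q) = fr y (pderiv p * F) q \<oplus> fr y (- (p * pderiv q * F)) (q * q)"
proof -
  have nz: "ev y q \<noteq> \<zero>" using y q by (simp add: ev_eq_0_iff)
  note i = inv_props(1)[OF ev_closed[OF y(1)] nz]
  have "D (fr y p q) = D (ev y p) \<otimes> inv (ev y q) \<oplus> ev y p \<otimes> D (inv (ev y q))"
    unfolding fr_def using y i by (simp add: D_mult)
  also have "D (ev y p) \<otimes> inv (ev y q) = fr y (pderiv p * F) q"
    using y F by (simp add: fr_def D_ev ev_mult)
  also have "ev y p \<otimes> D (inv (ev y q)) = fr y (- (p * pderiv q * F)) (q * q)"
    using y i nz F
    by (simp add: fr_def D_inv D_ev ev_mult ev_minus inv_mult_units l_minus r_minus m_ac)
  finally show ?thesis .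
qed

text \<open>The automorphism substitutes \<open>y'\<close> for \<open>y\<close> in rational functions; this is well defined since
  both are transcendental, and it commutes with D since both satisfy \<open>D y = F(y)\<close>.\<close>

lemma Gal_exists:
  assumes y: "y \<in> carrier L" "D y \<noteq> \<zero>" "carrier L = gen y" "D y = ev y F"
    and y': "y' \<in> carrier L" "D y' \<noteq> \<zero>" "carrier L = gen y'" "D y' = ev y' F"
  shows "\<exists>\<phi>\<in>carrier Gal. \<phi> y = y'"
proof -
  have "\<forall>x\<in>carrier L. \<exists>v. \<forall>p q. q \<noteq> 0 \<longrightarrow> x = fr y p q \<longrightarrow> v = fr y' p q"
  proof
    fix x assume "x \<in> carrier L"
    then obtain p q where "q \<noteq> 0" "x = fr y p q" using gen_fr y by metis
    thus "\<exists>v. \<forall>p q. q \<noteq> 0 \<longrightarrow> x = fr y p q \<longrightarrow> v = fr y' p q"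
      using fr_eq_iff[OF y(1,2)] fr_eq_iff[OF y'(1,2)] by (intro exI[of _ "fr y' p q"]) auto
  qed
  then obtain \<phi>0 where \<phi>0: "\<forall>x\<in>carrier L. \<forall>p q. q \<noteq> 0 \<longrightarrow> x = fr y p q \<longrightarrow> \<phi>0 x = fr y' p q"
    by metis
  \<comment> \<open>Elements of \<open>Bij\<close> must be extensional, hence the
    restriction.\<close>
  define \<phi> where "\<phi> = restrict \<phi>0 (carrier L)"
  have \<phi>: "\<phi> (fr y p q) = fr y' p q" if "q \<noteq> 0" for p q
    using \<phi>0[rule_format, OF fr_closed[OF y(1,2) that] that refl] fr_closed[OF y(1,2) that]
    by (simp add: \<phi>_def)
  have \<phi>_ev: "\<phi> (ev y p) = ev y' p" for p
    using \<phi>[of 1 p] fr_1[OF y(1,2)] fr_1[OF y'(1,2)] by simp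
  have repr: "\<exists>p q. q \<noteq> 0 \<and> x = fr y p q" if "x \<in> carrier L" for x
    using gen_fr y that by metis
  have closed: "\<phi> x \<in> carrier L" if x: "x \<in> carrier L" for x
    using repr[OF x] \<phi> fr_closed[OF y'(1,2)] by auto
  have add: "\<phi> (x \<oplus> z) = \<phi> x \<oplus> \<phi> z" if xz: "x \<in> carrier L" "z \<in> carrier L" for x z
    using repr[OF xz(1)] repr[OF xz(2)]
    by (auto simp: \<phi> fr_add[OF y(1,2)] fr_add[OF y'(1,2)])
  have mult: "\<phi> (x \<otimes> z) = \<phi> x \<otimes> \<phi> z" if xz: "x \<in> carrier L" "z \<in> carrier L" for x z
    using repr[OF xz(1)] repr[OF xz(2)]
    by (auto simp: \<phi> fr_mult[OF y(1,2)] fr_mult[OF y'(1,2)])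
  have \<iota>: "\<phi> (\<iota> z) = \<iota> z" for z
    using \<phi>_ev[of "[:z:]"] y(1) y'(1) by simp
  have \<phi>y: "\<phi> y = y'"
    using \<phi>_ev[of "[:0, 1:]"] y(1) y'(1) by simp
  have hom: "\<phi> \<in> ring_hom L L"
    using closed mult add \<iota>[of 1] by (intro ring_hom_memI) auto
  \<comment> \<open>The cross-multiplied identity obtained at \<open>y'\<close> is read back at
    y.\<close>
  have "inj_on \<phi> (carrier L)"
  proof (rule inj_onI)
    fix x z assume xz: "x \<in> carrier L" "z \<in> carrier L" "\<phi> x = \<phi> z"
    from repr[OF xz(1)] repr[OF xz(2)] obtain p q p' q'
      where "q \<noteq> 0" "x = fr y p q" "q' \<noteq> 0" "z = fr y p' q'" by blast
    thus "x = z" using xz(3) fr_eq_iff[OF y(1,2)] fr_eq_iff[OF y'(1,2)] \<phi> by simp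
  qed
  \<comment> \<open>Surjectivity rests on \<open>y'\<close> generating L as well.\<close>
  moreover have "\<phi> ` carrier L = carrier L"
  proof (intro equalityI subsetI)
    fix x assume "x \<in> carrier L"
    then obtain p q where "q \<noteq> 0" "x = fr y' p q" using gen_fr y' by metis
    thus "x \<in> \<phi> ` carrier L" using \<phi> fr_closed[OF y(1,2)] by (metis imageI)
  qed (use closed in auto)
  ultimately have Bij: "\<phi> \<in> Bij (carrier L)"
    by (simp add: Bij_def bij_betw_def \<phi>_def)
  have "\<phi> (D x) = D (\<phi> x)" if "x \<in> carrier L" for x
  proof -
    obtain p q where "q \<noteq> 0" "x = fr y p q" using repr \<open>x \<in> carrier L\<close> by blast
    thus ?thesis
      by (simp add: \<phi> D_fr[OF y(1,2,4)] D_fr[OF y'(1,2,4)] add fr_closed[OF y(1,2)])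
  qed
  with Bij hom \<iota> have "\<phi> \<in> carrier Gal" by (simp add: carrier_Gal)
  thus ?thesis using \<phi>y by blast
qed

text \<open>The common frame of the additive and the multiplicative case: \<open>act\<close> lists
  the possible images of y, and \<open>comp\<close> says how they compose. Since automorphisms are
  determined at y, both surjectivity and multiplicativity are checked there.\<close>

lemma Gal_iso:
  fixes G (structure) and act :: "'g \<Rightarrow> 'l"
  assumes y: "y \<in> carrier L" "D y \<noteq> \<zero>\<^bsub>L\<^esub>" "carrier L = gen y"
    and inj: "inj_on act (carrier G)"
    and closed: "\<And>\<mu> \<nu>. \<mu> \<in> carrier G \<Longrightarrow> \<nu> \<in> carrier G \<Longrightarrow> \<mu> \<otimes>\<^bsub>G\<^esub> \<nu> \<in> carrier G"
    and ex: "\<And>\<mu>. \<mu> \<in> carrier G \<Longrightarrow> \<exists>\<phi>\<in>carrier Gal. \<phi> y = act \<mu>"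
    and onto: "\<And>\<phi>. \<phi> \<in> carrier Gal \<Longrightarrow> \<exists>\<mu>\<in>carrier G. \<phi> y = act \<mu>"
    and comp: "\<And>\<phi> \<mu> \<nu>. \<phi> \<in> carrier Gal \<Longrightarrow> \<mu> \<in> carrier G \<Longrightarrow> \<nu> \<in> carrier G \<Longrightarrow>
      \<phi> y = act \<mu> \<Longrightarrow> \<phi> (act \<nu>) = act (\<mu> \<otimes>\<^bsub>G\<^esub> \<nu>)"
  shows "\<exists>\<phi>. (\<forall>\<mu>\<in>carrier G. \<phi> \<mu> y = act \<mu>) \<and> carrier Gal = \<phi> ` carrier G \<and> \<phi> \<in> iso G Gal"
proof -
  from ex obtain \<phi> where \<phi>: "\<And>\<mu>. \<mu> \<in> carrier G \<Longrightarrow> \<phi> \<mu> \<in> carrier Gal"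
    "\<And>\<mu>. \<mu> \<in> carrier G \<Longrightarrow> \<phi> \<mu> y = act \<mu>" by metis
  have img: "carrier Gal = \<phi> ` carrier G"
  proof (intro equalityI subsetI)
    fix \<psi> assume \<psi>: "\<psi> \<in> carrier Gal"
    then obtain \<mu> where "\<mu> \<in> carrier G" "\<psi> y = act \<mu>" using onto by blast
    thus "\<psi> \<in> \<phi> ` carrier G" using Gal_eqI[OF y \<psi>] \<phi> by (metis imageI)
  qed (use \<phi> in auto)
  have "inj_on \<phi> (carrier G)"
    using inj \<phi>(2) unfolding inj_on_def by metis
  moreover have "\<phi> \<in> hom G Gal"
  proof (rule homI)
    fix \<mu> \<nu> assume \<mu>\<nu>: "\<mu> \<in> carrier G" "\<nu> \<in> carrier G"
    \<comment> \<open>\<open>Gal_eqI\<close> compares automorphisms only, so the composite must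
      first be known to be one.\<close>
    have *: "compose (carrier L) (\<phi> \<mu>) (\<phi> \<nu>) \<in> carrier Gal"
    proof -
      have a: "\<phi> \<mu> \<in> carrier Gal" "\<phi> \<nu> \<in> carrier Gal" using \<phi> \<mu>\<nu> by auto
      hence "compose (carrier L) (\<phi> \<mu>) (\<phi> \<nu>) \<in> Bij (carrier L)"
        by (auto simp: carrier_Gal intro: compose_Bij)
      moreover have "compose (carrier L) (\<phi> \<mu>) (\<phi> \<nu>) \<in> ring_hom L L"
        using a by (intro ring_hom_memI)
          (auto simp: carrier_Gal compose_def ring_hom_closed ring_hom_add ring_hom_mult ring_hom_one)
      ultimately show ?thesis
        using a by (auto simp: carrier_Gal compose_def ring_hom_closed)
    qed
    have "compose (carrier L) (\<phi> \<mu>) (\<phi> \<nu>) y = \<phi> (\<mu> \<otimes>\<^bsub>G\<^esub> \<nu>) y"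
      using \<phi> \<mu>\<nu> closed comp[OF \<phi>(1)] y by (simp add: compose_def)
    thus "\<phi> (\<mu> \<otimes>\<^bsub>G\<^esub> \<nu>) = \<phi> \<mu> \<otimes>\<^bsub>Gal\<^esub> \<phi> \<nu>"
      using Gal_eqI[OF y * \<phi>(1)[OF closed[OF \<mu>\<nu>]]] \<phi>(1) \<mu>\<nu> by (simp add: mult_Gal)
  qed (use \<phi> in auto)
  ultimately show ?thesis
    using \<phi>(2) img by (intro exI[of _ \<phi>]) (auto simp: iso_def bij_betw_def)
qed

section \<open>Uniqueness for first order equations\<close>

text \<open>The difference has derivative zero and is therefore a constant.\<close>

lemma eq_D_imp_add_constant:
  assumes "x \<in> carrier L" "y \<in> carrier L" "D x = D y"
  obtains z where "x = y \<oplus> \<iota> z"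
proof -
  have "D (x \<oplus> \<ominus> y) = \<zero>"
    using assms D_closed[OF assms(2)] by (simp add: D_add D_minus r_neg del: D_closed)
  then obtain z where "x \<oplus> \<ominus> y = \<iota> z" using constant_iff[of "x \<oplus> \<ominus> y"] assms by auto
  moreover have "x = y \<oplus> (x \<oplus> \<ominus> y)"
    using assms by (simp add: a_lcomm r_neg)
  ultimately show ?thesis using that by simp
qed

text \<open>The quotient \<open>x \<otimes> inv y\<close> has derivative zero and is therefore a
  constant.\<close>

lemma eq_log_deriv_imp_mult_constant:
  assumes c: "c \<in> carrier L" and x: "x \<in> carrier L" "D x = c \<otimes> x"
    and y: "y \<in> carrier L" "y \<noteq> \<zero>" "D y = c \<otimes> y"
  obtains z where "x = \<iota> z \<otimes> y"
proof -
  note i = inv_props[OF y(1,2)]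
  have Di: "D (inv y) = \<ominus> (c \<otimes> (y \<otimes> inv y) \<otimes> inv y)"
    using y c i(1) D_inv[OF y(1,2)] by (simp add: m_assoc)
  have "D (x \<otimes> inv y) = c \<otimes> x \<otimes> inv y \<oplus> x \<otimes> (\<ominus> (c \<otimes> inv y))"
    using x i(1) c i(3) Di by (simp add: D_mult)
  also have "\<dots> = \<zero>" using x i(1) c by (simp add: r_minus m_ac r_neg)
  finally obtain z where z: "x \<otimes> inv y = \<iota> z"
    using constant_iff[of "x \<otimes> inv y"] x i(1) by auto
  have "x = (x \<otimes> inv y) \<otimes> y" using x y i(1,4) by (simp add: m_assoc)
  thus ?thesis using that z by simp
qed

lemma \<iota>_in_gen: "\<iota> z \<in> gen y"
  by (simp add: generate_field.incl)

lemma self_in_gen: "y \<in> gen y"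
  by (simp add: generate_field.incl)

text \<open>\<open>gen y\<close> is a subfield stable under D that contains K and both solutions, so
  it must be all of L.\<close>

lemma carrier_eq_gen:
  assumes "differentially_generated L D (range \<iota> \<union> {y1, y2})"
    and y: "y \<in> carrier L" "D y \<in> gen y" and y12: "y1 \<in> gen y" "y2 \<in> gen y"
  shows "carrier L = gen y"
proof -
  have "subfield (gen y) L" using y by (intro generate_field_is_subfield) auto
  moreover have "D ` gen y \<subseteq> gen y" using gen_D_closed[OF y] by auto
  ultimately show ?thesis
    using assms(1) y12 \<iota>_in_gen unfolding differentially_generated_def by auto
qed

end

section \<open>Picard-Vessiot extensions for constant coefficients\<close>

text \<open>Fixes the two generating solutions of \<open>picard_vessiot\<close>. As the constants
  are the range of \<open>\<iota>\<close>, independence is stated with coefficients in K.\<close>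

locale constant_picard_vessiot = constant_differential_field L D \<iota>
  for L :: "('l, 'm) ring_scheme" (structure) and D and \<iota> :: "'k :: field_char_0 \<Rightarrow> 'l" +
  fixes \<rho> :: 'k and y1 y2 :: 'l
  assumes sol_closed: "y1 \<in> carrier L" "y2 \<in> carrier L"
    and sol: "D (D y1) = \<iota> \<rho> \<otimes> y1" "D (D y2) = \<iota> \<rho> \<otimes> y2"
    and indep: "\<And>z w. \<iota> z \<otimes> y1 \<oplus> \<iota> w \<otimes> y2 = \<zero> \<Longrightarrow> z = 0 \<and> w = 0"
    and generated: "differentially_generated L D (range \<iota> \<union> {y1, y2})"
begin

section \<open>The additive case\<close>

text \<open>A solution u has constant derivative c, so u and c y differ by a constant and u lies in
  K(y).\<close>

lemma carrier_eq_gen_additive: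
  assumes "\<rho> = 0" and y: "y \<in> carrier L" "D y = \<one>"
  shows "carrier L = gen y"
proof -
  have "u \<in> gen y" if u: "u \<in> carrier L" "D (D u) = \<zero>" for u
  proof -
    obtain c where c: "D u = \<iota> c" using constant_iff[of "D u"] u by auto
    hence "D u = D (\<iota> c \<otimes> y)" using y by (simp add: D_\<iota>_mult)
    then obtain z where "u = \<iota> c \<otimes> y \<oplus> \<iota> z"
      using eq_D_imp_add_constant u y by (metis \<iota>_closed m_closed)
    thus ?thesis by (simp add: generate_field.eng_add generate_field.eng_mult \<iota>_in_gen self_in_gen)
  qed
  moreover have "D y \<in> gen y" using y generate_field.one by simp
  ultimately show ?thesis
    using sol sol_closed assms(1) by (intro carrier_eq_gen[OF generated y(1)]) simp_all
qed

text \<open>Two constants are linearly dependent, so one of the solutions has a nonzero derivative.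
  This derivative is constant and can be scaled to one.\<close>

lemma ex_additive:
  assumes "\<rho> = 0"
  shows "\<exists>y\<in>carrier L. D y = \<one>"
proof -
  have *: ?thesis if u: "u \<in> carrier L" "D (D u) = \<zero>" "D u \<noteq> \<zero>" for u
  proof -
    obtain c where c: "D u = \<iota> c" using constant_iff[of "D u"] u by auto
    hence "D (\<iota> (inverse c) \<otimes> u) = \<one>"
      using u by (simp add: D_\<iota>_mult flip: \<iota>_mult)
    thus ?thesis using u by (metis \<iota>_closed m_closed)
  qed
  have "D y1 \<noteq> \<zero> \<or> D y2 \<noteq> \<zero>"
  proof (rule ccontr)
    assume "\<not> ?thesis"
    then obtain a b where ab: "y1 = \<iota> a" "y2 = \<iota> b"
      using constant_iff sol_closed by (metis rangeE)
    \<comment> \<open>The relation b a - a b = 0 between the constants gives b = 0; then y2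
      vanishes, which contradicts independence.\<close>
    have "\<iota> b \<otimes> y1 \<oplus> \<iota> (- a) \<otimes> y2 = \<iota> (b * a + - a * b)"
      unfolding ab by (simp only: \<iota>_add \<iota>_mult)
    hence "b = 0" using indep[of b "- a"] by simp
    thus False using ab indep[of 0 1] by simp
  qed
  thus ?thesis using * sol sol_closed assms by auto
qed

text \<open>An automorphism preserves \<open>D y = \<one>\<close>, so it moves y by a constant.
  Conversely every translate of y solves \<open>D y = F(y)\<close> with F = 1, and composition adds
  the constants.\<close>

lemma Gal_additive:
  assumes "\<rho> = 0" and y: "y \<in> carrier L" "D y = \<one>"
  shows "\<exists>\<phi>. (\<forall>\<mu>. \<phi> \<mu> y = y \<oplus> \<iota> \<mu>) \<and> carrier Gal = range \<phi> \<and>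
           \<phi> \<in> iso (add_monoid ring_of_type_algebra) Gal"
proof -
  let ?G = "add_monoid (ring_of_type_algebra :: 'k ring)"
  have act: "y \<oplus> \<iota> \<mu> \<in> carrier L" "D (y \<oplus> \<iota> \<mu>) = \<one>" for \<mu>
    using y by (simp_all add: D_add)
  have "\<exists>\<phi>. (\<forall>\<mu>\<in>carrier ?G. \<phi> \<mu> y = y \<oplus> \<iota> \<mu>) \<and> carrier Gal = \<phi> ` carrier ?G \<and> \<phi> \<in> iso ?G Gal"
  proof (rule Gal_iso)
    show "y \<in> carrier L" "D y \<noteq> \<zero>" "carrier L = gen y"
      using carrier_eq_gen_additive[OF assms] y by auto
    show "inj_on (\<lambda>\<mu>. y \<oplus> \<iota> \<mu>) (carrier ?G)"
      using y by (auto intro!: inj_onI \<iota>_inj)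
    show "\<exists>\<phi>\<in>carrier Gal. \<phi> y = y \<oplus> \<iota> \<mu>" for \<mu>
      using carrier_eq_gen_additive[OF assms(1)] y act
      by (intro Gal_exists[where F = 1]) auto
    show "\<exists>\<mu>\<in>carrier ?G. \<phi> y = y \<oplus> \<iota> \<mu>" if \<phi>: "\<phi> \<in> carrier Gal" for \<phi>
    proof -
      have hom: "\<phi> \<in> ring_hom L L" "\<phi> (D y) = D (\<phi> y)"
        using \<phi> y(1) by (simp_all add: carrier_Gal)
      have "\<phi> y \<in> carrier L" "D (\<phi> y) = D y"
        using hom y ring_hom_closed[OF hom(1)] ring_hom_one[OF hom(1)] by metis+
      then obtain \<mu> where "\<phi> y = y \<oplus> \<iota> \<mu>"
        using y(1) by (blast intro: eq_D_imp_add_constant)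
      thus ?thesis by auto
    qed
    show "\<phi> (y \<oplus> \<iota> \<nu>) = y \<oplus> \<iota> (\<mu> \<otimes>\<^bsub>?G\<^esub> \<nu>)" if "\<phi> \<in> carrier Gal" "\<phi> y = y \<oplus> \<iota> \<mu>" for \<phi> \<mu> \<nu>
      using that y by (simp add: carrier_Gal ring_hom_add[of \<phi> L L] \<iota>_add a_assoc)
  qed auto
  thus ?thesis by auto
qed

section \<open>The multiplicative case\<close>

context
  fixes s :: 'k assumes s: "s ^ 2 = \<rho>" "s \<noteq> 0"
begin

text \<open>From the factorization D^2 - \<rho> = (D - t)(D + t). Both roots t = s and t = -s are
  used.\<close>

lemma D_eigen:
  assumes "t ^ 2 = \<rho>" "u \<in> carrier L" "D (D u) = \<iota> \<rho> \<otimes> u"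
  shows "D (D u \<oplus> \<iota> t \<otimes> u) = \<iota> t \<otimes> (D u \<oplus> \<iota> t \<otimes> u)"
proof -
  have "\<iota> \<rho> = \<iota> t \<otimes> \<iota> t" using assms(1) \<iota>_mult[of t t] by (simp add: power2_eq_square)
  thus ?thesis using assms(2,3) by (simp add: D_add D_\<iota>_mult r_distr m_assoc a_comm)
qed

text \<open>Recovers u from its two eigencomponents: (D + s)u - (D - s)u = 2 s u, and 2 s is
  invertible.\<close>

lemma eq_eigen_diff:
  assumes "u \<in> carrier L"
  shows "u = \<iota> (inverse (2 * s)) \<otimes> ((D u \<oplus> \<iota> s \<otimes> u) \<ominus> (D u \<oplus> \<iota> (- s) \<otimes> u))"
proof -
  have "(D u \<oplus> \<iota> s \<otimes> u) \<ominus> (D u \<oplus> \<iota> (- s) \<otimes> u)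
      = (D u \<oplus> \<ominus> D u) \<oplus> (\<iota> s \<otimes> u \<oplus> \<iota> s \<otimes> u)"
    using assms by (simp add: \<iota>_minus a_minus_def minus_add l_minus a_ac)
  also have "\<dots> = \<iota> (2 * s) \<otimes> u"
    unfolding mult_2 \<iota>_add using assms by (simp add: r_neg l_distr)
  finally show ?thesis
    using assms s \<iota>_mult[of "inverse (2 * s)" "2 * s", symmetric] by (simp flip: m_assoc)
qed

text \<open>The eigencomponents of a solution are constant multiples of y and of
  \<open>inv y\<close>, both of which lie in K(y).\<close>

lemma carrier_eq_gen_multiplicative:
  assumes y: "y \<in> carrier L" "y \<noteq> \<zero>" "D y = \<iota> s \<otimes> y"
  shows "carrier L = gen y"
proof -
  note i = inv_props[OF y(1,2)]
  have inv_gen: "inv y \<in> gen y" using y(2) self_in_gen by (rule generate_field.m_inv[rotated])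
  have Dinv: "D (inv y) = \<iota> (- s) \<otimes> inv y"
    using y i by (simp add: D_inv m_assoc \<iota>_minus l_minus)
  have "u \<in> gen y" if u: "u \<in> carrier L" "D (D u) = \<iota> \<rho> \<otimes> u" for u
  proof -
    have "D (D u \<oplus> \<iota> s \<otimes> u) = \<iota> s \<otimes> (D u \<oplus> \<iota> s \<otimes> u)"
      using D_eigen[OF s(1) u] .
    then obtain z where z: "D u \<oplus> \<iota> s \<otimes> u = \<iota> z \<otimes> y"
      using eq_log_deriv_imp_mult_constant[OF \<iota>_closed _ _ y] u
      by (metis D_closed \<iota>_closed a_closed m_closed)
    have "D (D u \<oplus> \<iota> (- s) \<otimes> u) = \<iota> (- s) \<otimes> (D u \<oplus> \<iota> (- s) \<otimes> u)"
      using D_eigen[OF _ u, of "- s"] s(1) by simp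
    then obtain w where w: "D u \<oplus> \<iota> (- s) \<otimes> u = \<iota> w \<otimes> inv y"
      using eq_log_deriv_imp_mult_constant[OF \<iota>_closed _ _ i(1,2) Dinv] u
      by (metis D_closed \<iota>_closed a_closed m_closed)
    show ?thesis
      by (subst eq_eigen_diff[OF u(1)], unfold z w a_minus_def)
         (intro generate_field.eng_add generate_field.eng_mult generate_field.a_inv
           \<iota>_in_gen self_in_gen inv_gen)
  qed
  moreover have "D y \<in> gen y"
    unfolding y(3) by (intro generate_field.eng_mult \<iota>_in_gen self_in_gen)
  ultimately show ?thesis
    using sol sol_closed by (intro carrier_eq_gen[OF generated y(1)]) simp_all
qed

text \<open>If (D + s)y1 is nonzero, it is the required element. Otherwise (D - s)y1 is nonzero with
  eigenvalue -s, and its inverse has eigenvalue s.\<close>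

lemma ex_multiplicative: "\<exists>y\<in>carrier L. y \<noteq> \<zero> \<and> D y = \<iota> s \<otimes> y"
proof (cases "D y1 \<oplus> \<iota> s \<otimes> y1 = \<zero>")
  case False
  moreover have "D y1 \<oplus> \<iota> s \<otimes> y1 \<in> carrier L" using sol_closed by simp
  ultimately show ?thesis using D_eigen[OF s(1) sol_closed(1) sol(1)] by blast
next
  case True
  define v where "v = D y1 \<oplus> \<iota> (- s) \<otimes> y1"
  have v: "v \<in> carrier L" "D v = \<iota> (- s) \<otimes> v"
    unfolding v_def using sol_closed s(1) by (simp, intro D_eigen[OF _ sol_closed(1) sol(1)], simp)
  have "v \<noteq> \<zero>"
  proof
    assume "v = \<zero>"
    hence "y1 = \<zero>" using eq_eigen_diff[OF sol_closed(1)] True by (simp add: v_def a_minus_def)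
    thus False using indep[of 1 0] sol_closed by simp
  qed
  note i = inv_props[OF v(1) this]
  have "D (inv v) = \<iota> s \<otimes> inv v"
    using v i \<open>v \<noteq> \<zero>\<close> by (simp add: D_inv m_assoc \<iota>_minus l_minus)
  thus ?thesis using i by blast
qed

text \<open>The image of y has the same logarithmic derivative as y, so it is a constant multiple.
  Conversely every nonzero multiple satisfies the same equation and generates L.\<close>

lemma Gal_multiplicative:
  assumes y: "y \<in> carrier L" "y \<noteq> \<zero>" "D y = \<iota> s \<otimes> y"
  shows "\<exists>\<phi>. (\<forall>\<mu>. \<mu> \<noteq> 0 \<longrightarrow> \<phi> \<mu> y = \<iota> \<mu> \<otimes> y) \<and> carrier Gal = \<phi> ` {\<mu>. \<mu> \<noteq> 0} \<and>
           \<phi> \<in> iso (units_of ring_of_type_algebra) Gal"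
proof -
  let ?G = "units_of (ring_of_type_algebra :: 'k ring)"
  have "Units (ring_of_type_algebra :: 'k ring) = UNIV - {0}"
    using Ring.field.field_Units[OF field_from_type_algebra] by simp
  hence G: "carrier ?G = {\<mu>. \<mu> \<noteq> 0}"
    by (auto simp: units_of_carrier)
  have G_mult: "\<mu> \<otimes>\<^bsub>?G\<^esub> \<nu> = \<mu> * \<nu>" for \<mu> \<nu>
    by (simp add: units_of_mult)
  have Dnz: "D y \<noteq> \<zero>" using y s integral[of "\<iota> s" y] by auto
  have nz: "\<iota> \<mu> \<otimes> y \<noteq> \<zero>" if "\<mu> \<noteq> 0" for \<mu>
    using that y integral[of "\<iota> \<mu>" y] by auto
  have D_act: "D (\<iota> \<mu> \<otimes> y) = \<iota> s \<otimes> (\<iota> \<mu> \<otimes> y)" for \<mu>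
    using y by (simp add: D_\<iota>_mult m_lcomm)
  have "\<exists>\<phi>. (\<forall>\<mu>\<in>carrier ?G. \<phi> \<mu> y = \<iota> \<mu> \<otimes> y) \<and> carrier Gal = \<phi> ` carrier ?G \<and> \<phi> \<in> iso ?G Gal"
  proof (rule Gal_iso)
    show "y \<in> carrier L" "D y \<noteq> \<zero>" "carrier L = gen y"
      using carrier_eq_gen_multiplicative[OF y] y Dnz by auto
    show "inj_on (\<lambda>\<mu>. \<iota> \<mu> \<otimes> y) (carrier ?G)"
      using y by (auto intro!: inj_onI \<iota>_inj simp: m_rcancel)
    show "\<mu> \<otimes>\<^bsub>?G\<^esub> \<nu> \<in> carrier ?G" if "\<mu> \<in> carrier ?G" "\<nu> \<in> carrier ?G" for \<mu> \<nu>
      using that unfolding G_mult G by simp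
    show "\<exists>\<phi>\<in>carrier Gal. \<phi> y = \<iota> \<mu> \<otimes> y" if "\<mu> \<in> carrier ?G" for \<mu>
    \<comment> \<open>The polynomial s X encodes \<open>D y = \<iota> s \<otimes> y\<close>.\<close>
    proof (rule Gal_exists[where F = "[:0, s:]"])
      have \<mu>: "\<mu> \<noteq> 0" using that by (simp add: G)
      show "D (\<iota> \<mu> \<otimes> y) \<noteq> \<zero>"
        unfolding D_act using nz[OF \<mu>] s y integral[of "\<iota> s" "\<iota> \<mu> \<otimes> y"] by auto
      show "carrier L = gen (\<iota> \<mu> \<otimes> y)"
        using nz[OF \<mu>] D_act y by (intro carrier_eq_gen_multiplicative) auto
      show "D (\<iota> \<mu> \<otimes> y) = ev (\<iota> \<mu> \<otimes> y) [:0, s:]"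
        unfolding D_act using y by (simp add: m_ac)
      show "D y = ev y [:0, s:]" using y by (simp add: m_comm)
      show "y \<in> carrier L" "D y \<noteq> \<zero>" "carrier L = gen y" "\<iota> \<mu> \<otimes> y \<in> carrier L"
        using y(1) Dnz carrier_eq_gen_multiplicative[OF y] by (blast intro: m_closed \<iota>_closed)+
    qed
    show "\<exists>\<mu>\<in>carrier ?G. \<phi> y = \<iota> \<mu> \<otimes> y" if \<phi>: "\<phi> \<in> carrier Gal" for \<phi>
    proof -
      have hom: "\<phi> \<in> ring_hom L L" "\<phi> (D y) = D (\<phi> y)" "\<And>z. \<phi> (\<iota> z) = \<iota> z"
        "inj_on \<phi> (carrier L)"
        using \<phi> y(1) unfolding carrier_Gal Bij_def bij_betw_def by blast+
      have "\<phi> y \<in> carrier L" using hom y by (simp add: ring_hom_closed)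
      moreover have "D (\<phi> y) = \<iota> s \<otimes> \<phi> y"
        unfolding hom(2)[symmetric] y(3) using y(1) by (simp add: ring_hom_mult[OF hom(1)] hom(3))
      ultimately obtain \<mu> where \<mu>: "\<phi> y = \<iota> \<mu> \<otimes> y"
        using eq_log_deriv_imp_mult_constant[OF \<iota>_closed _ _ y] by metis
      \<comment> \<open>Otherwise y and zero would have the same image, against injectivity.\<close>
      have "\<mu> \<noteq> 0"
      proof
        assume "\<mu> = 0"
        hence "\<phi> y = \<phi> \<zero>" using \<mu> y(1) hom(3)[of 0] by simp
        thus False using hom(4) y(1,2) by (meson inj_onD zero_closed)
      qed
      thus ?thesis using \<mu> G by auto
    qed
    show "\<phi> (\<iota> \<nu> \<otimes> y) = \<iota> (\<mu> \<otimes>\<^bsub>?G\<^esub> \<nu>) \<otimes> y"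
      if "\<phi> \<in> carrier Gal" "\<phi> y = \<iota> \<mu> \<otimes> y" for \<phi> \<mu> \<nu>
      using that y
      by (simp add: carrier_Gal ring_hom_mult[of \<phi> L L] G_mult \<iota>_mult m_ac)
  qed
  thus ?thesis unfolding G by simp
qed

end

end

text \<open>With the zero derivation all of K is constant, so \<open>constants L D\<close> becomes
  the range of \<open>\<iota>\<close> and the locale applies.\<close>

lemma picard_vessiot_imp:
  fixes \<iota> :: "'k :: field_char_0 \<Rightarrow> 'l"
  assumes "picard_vessiot ring_of_type_algebra (\<lambda>_. 0) L D \<iota> \<rho>"
  obtains y1 y2 where "constant_picard_vessiot L D \<iota> \<rho> y1 y2"
proof -
  from assms have de: "differential_field L D" "\<iota> \<in> ring_hom ring_of_type_algebra L"
    and const: "constants L D = range \<iota>"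
    by (auto simp: picard_vessiot_def differential_extension_def constants_def)
  interpret Ring.field L using de(1) by (simp add: differential_field_def)
  interpret constant_differential_field L D \<iota>
    using de const
    by unfold_locales (auto simp: differential_field_def constants_def set_eq_iff)
  from assms obtain y1 y2 where "y1 \<in> carrier L" "y2 \<in> carrier L"
    "D (D y1) = \<iota> \<rho> \<otimes>\<^bsub>L\<^esub> y1" "D (D y2) = \<iota> \<rho> \<otimes>\<^bsub>L\<^esub> y2"
    "\<forall>c1\<in>constants L D. \<forall>c2\<in>constants L D.
       (c1 \<otimes>\<^bsub>L\<^esub> y1) \<oplus>\<^bsub>L\<^esub> (c2 \<otimes>\<^bsub>L\<^esub> y2) = \<zero>\<^bsub>L\<^esub> \<longrightarrow> c1 = \<zero>\<^bsub>L\<^esub> \<and> c2 = \<zero>\<^bsub>L\<^esub>"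
    "differentially_generated L D (range \<iota> \<union> {y1, y2})"
    unfolding picard_vessiot_def by auto
  hence "constant_picard_vessiot L D \<iota> \<rho> y1 y2"
    unfolding const by unfold_locales auto
  thus ?thesis by (rule that)
qed

section \<open>The reduction\<close>

text \<open>The exponential factor removes the first order term and leaves the coefficient (a + b)^2
  - (a^2 + c + b^2) = 2ab - c.\<close>

lemma ex_system_solution_iff:
  assumes x: "\<And>t. x t = exp ((a + b) * t) * u t"
  shows "(\<exists>y. system_solution a b c x y) \<longleftrightarrow> reduced_solution (2 * a * b - c) u"
proof
  assume "\<exists>y. system_solution a b c x y"
  then obtain y where dx: "\<And>t. (x has_field_derivative y t) (at t)"
    and dy: "\<And>t. (y has_field_derivative 2 * (a + b) * y t - (a^2 + c + b^2) * x t) (at t)"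
    unfolding system_solution_def by blast
  have u: "u = (\<lambda>t. exp (- (a + b) * t) * x t)"
    by (simp add: x fun_eq_iff algebra_simps flip: exp_add mult.assoc)
  \<comment> \<open>The derivative of u by the product rule, with y in place of the derivative of
    x.\<close>
  let ?v = "\<lambda>t. exp (- (a + b) * t) * (y t - (a + b) * x t)"
  have "(u has_field_derivative ?v t) (at t)" for t
    unfolding u by (rule derivative_eq_intros refl dx | simp add: algebra_simps)+
  moreover have "(?v has_field_derivative (2 * a * b - c) * u t) (at t)" for t
    unfolding u
    by (rule derivative_eq_intros refl dx dy | simp add: algebra_simps power2_eq_square)+
  ultimately show "reduced_solution (2 * a * b - c) u"
    unfolding reduced_solution_def by (intro exI[of _ ?v]) blast
next
  assume "reduced_solution (2 * a * b - c) u"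
  then obtain v where du: "\<And>t. (u has_field_derivative v t) (at t)"
    and dv: "\<And>t. (v has_field_derivative (2 * a * b - c) * u t) (at t)"
    unfolding reduced_solution_def by blast
  have x': "x = (\<lambda>t. exp ((a + b) * t) * u t)" using x by blast
  \<comment> \<open>The second component of the system has to be the derivative of x.\<close>
  let ?y = "\<lambda>t. exp ((a + b) * t) * (v t + (a + b) * u t)"
  have "(x has_field_derivative ?y t) (at t)" for t
    unfolding x' by (rule derivative_eq_intros refl du | simp add: algebra_simps)+
  moreover have "(?y has_field_derivative 2 * (a + b) * ?y t - (a^2 + c + b^2) * x t) (at t)" for t
    unfolding x'
    by (rule derivative_eq_intros refl du dv | simp add: algebra_simps power2_eq_square)+
  ultimately show "\<exists>y. system_solution a b c x y"
    unfolding system_solution_def by (intro exI[of _ ?y]) blast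
qed

section \<open>The Laurent series models\<close>

text \<open>The field of all Laurent series already has only the complex numbers as constants, and
  its differential subfields containing them inherit this.\<close>

lemma constant_differential_field_fls:
  "constant_differential_field (ring_of_type_algebra :: complex fls ring) fls_deriv fls_const"
proof -
  interpret Ring.field "ring_of_type_algebra :: complex fls ring" by (rule field_from_type_algebra)
  show "constant_differential_field (ring_of_type_algebra :: complex fls ring) fls_deriv fls_const"
  proof unfold_locales
    show "fls_const \<in> ring_hom complex_field ring_of_type_algebra"
      by (intro ring_hom_memI) (simp_all add: fls_plus_const)
  next
    fix x :: "complex fls"
    show "fls_deriv x = \<zero>\<^bsub>ring_of_type_algebra\<^esub> \<longleftrightarrow> x \<in> range fls_const"
      using fls_deriv_eq_0_iff[of x] by auto
  qed simp_all
qed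

text \<open>Derivation and constants come from the ambient Laurent series. Generation holds because
  f is one of the two solutions: a subfield containing the constants and both solutions contains all
  of C(f).\<close>

lemma picard_vessiot_complex_functions:
  fixes f y1 y2 :: "complex fls"
  defines "H \<equiv> simple_extension complex_field ring_of_type_algebra fls_const f"
  assumes f': "fls_deriv f \<in> H"
    and y12: "y1 \<in> H" "y2 \<in> H" "f \<in> {y1, y2}"
    and sol: "fls_deriv (fls_deriv y1) = fls_const \<rho> * y1"
      "fls_deriv (fls_deriv y2) = fls_const \<rho> * y2"
    and indep: "\<And>z w. fls_const z * y1 + fls_const w * y2 = 0 \<Longrightarrow> z = 0 \<and> w = 0"
  shows "picard_vessiot complex_field (\<lambda>_. 0) (complex_functions f) fls_deriv fls_const \<rho>"
proof -
  let ?R = "ring_of_type_algebra :: complex fls ring"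
  interpret fls: constant_differential_field ?R fls_deriv fls_const
    by (rule constant_differential_field_fls)
  let ?L = "complex_functions f"
  have H: "H = generate_field ?R (insert f (range fls_const))"
    by (simp add: H_def simple_extension_def)
  have L: "?L = ?R\<lparr>carrier := H\<rparr>" by (simp add: complex_functions_def H_def)
  have L_field: "Ring.field ?L" unfolding L H by (rule fls.generate_field_is_field) simp
  have const_in_H: "fls_const z \<in> H" for z unfolding H by (rule fls.\<iota>_in_gen)
  have deriv: "fls_deriv x \<in> H" if "x \<in> H" for x
    using fls.gen_D_closed[of f x] f' that by (simp add: H)
  have "differential_field ?L fls_deriv"
    unfolding differential_field_def using L_field deriv by (simp add: L add.commute)
  moreover have "differential_field complex_field (\<lambda>_. 0)"
    unfolding differential_field_def using field_from_type_algebra by simp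
  moreover have "fls_const \<in> ring_hom complex_field ?L"
    using const_in_H by (intro ring_hom_memI) (simp_all add: L fls_plus_const)
  ultimately have "differential_extension complex_field (\<lambda>_. 0) ?L fls_deriv fls_const"
    by (simp add: differential_extension_def)
  moreover have const: "constants ?L fls_deriv = range fls_const"
    using fls.constant_iff const_in_H by (auto simp: constants_def L)
  moreover have "constants complex_field (\<lambda>_. 0) = UNIV" by (simp add: constants_def)
  moreover have "M = carrier ?L"
    if M: "subfield M ?L" "range fls_const \<union> {y1, y2} \<subseteq> M" for M
  proof -
    interpret Ring.field ?L by (rule L_field)
    have MH: "M \<subseteq> H" using subfieldE(3)[OF M(1)] by (simp add: L)
    \<comment> \<open>M is moved from C(f) to the full Laurent series field, where minimality of
      \<open>generate_field\<close> applies.\<close>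
    have "Ring.field (?R\<lparr>carrier := M\<rparr>)" using subfield_iff(2)[OF M(1)] by (simp add: L)
    hence "subfield M ?R" by (intro fls.subfield_iff(1)) simp_all
    hence "H \<subseteq> M" unfolding H using M(2) y12(3) by (intro fls.generate_field_min_subfield1) auto
    with MH show ?thesis by (simp add: L)
  qed
  hence "differentially_generated ?L fls_deriv (range fls_const \<union> {y1, y2})"
    unfolding differentially_generated_def by blast
  ultimately show ?thesis
    unfolding picard_vessiot_def using y12(1,2) sol indep
    by (intro conjI bexI[of _ y1] bexI[of _ y2]) (auto simp: L)
qed

text \<open>The solutions are 1 and t; differentiating a linear relation isolates the coefficient of
  t.\<close>

lemma picard_vessiot_fls_X:
  "picard_vessiot complex_field (\<lambda>_. 0) (complex_functions fls_X) fls_deriv fls_const 0"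
proof (rule picard_vessiot_complex_functions[of _ 1 fls_X])
  interpret fls: constant_differential_field "ring_of_type_algebra :: complex fls ring" fls_deriv fls_const
    by (rule constant_differential_field_fls)
  let ?H = "simple_extension complex_field (ring_of_type_algebra :: complex fls ring) fls_const fls_X"
  show "fls_deriv fls_X \<in> ?H" "1 \<in> ?H" "fls_X \<in> ?H"
    using generate_field.one[of "ring_of_type_algebra :: complex fls ring"]
    by (auto simp: simple_extension_def intro: fls.self_in_gen)
  fix z w :: complex
  assume *: "fls_const z * 1 + fls_const w * fls_X = 0"
  hence "fls_deriv (fls_const z * 1 + fls_const w * fls_X) = 0" by simp
  hence "w = 0" by simp
  with * show "z = 0 \<and> w = 0" by simp
qed simp_all

text \<open>The solutions are the exponentials with exponents s and -s; the second is the inverse of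
  the first and so lies in the field generated by it.\<close>

lemma picard_vessiot_fls_exp:
  assumes "s \<noteq> 0"
  shows "picard_vessiot complex_field (\<lambda>_. 0) (complex_functions (fps_to_fls (fps_exp s)))
           fls_deriv fls_const (s ^ 2)"
proof -
  interpret fls: constant_differential_field "ring_of_type_algebra :: complex fls ring" fls_deriv fls_const
    by (rule constant_differential_field_fls)
  define e where "e t = fps_to_fls (fps_exp t)" for t :: complex
  let ?H = "simple_extension complex_field (ring_of_type_algebra :: complex fls ring) fls_const (e s)"
  have De: "fls_deriv (e t) = fls_const t * e t" for t
    by (simp add: e_def fls_deriv_fps_to_fls fls_times_fps_to_fls)
  have ee: "e s * e (- s) = 1"
    by (simp add: e_def flip: fls_times_fps_to_fls fps_exp_add_mult)
  have nz: "e s \<noteq> 0" using ee by auto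
  have eH: "e s \<in> ?H" by (simp add: simple_extension_def fls.self_in_gen)
  have "inv\<^bsub>ring_of_type_algebra\<^esub> (e s) = e (- s)"
    using ee by (intro fls.comm_inv_char) simp_all
  hence "e (- s) \<in> ?H"
    using generate_field.m_inv[of "e s" "ring_of_type_algebra :: complex fls ring"] eH nz
    by (simp add: simple_extension_def)
  moreover have "fls_deriv (e s) \<in> ?H"
    using generate_field.eng_mult[of _ "ring_of_type_algebra :: complex fls ring"] eH
    by (simp add: De simple_extension_def fls.\<iota>_in_gen)
  moreover have "z = 0 \<and> w = 0" if *: "fls_const z * e s + fls_const w * e (- s) = 0" for z w
  proof -
    \<comment> \<open>Differentiation turns the sum into s times the difference; as s is nonzero,
      both vanish, and so does each term.\<close>
    have "fls_const s * (fls_const z * e s - fls_const w * e (- s))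
        = fls_deriv (fls_const z * e s + fls_const w * e (- s))"
      by (simp add: De algebra_simps)
    hence "fls_const z * e s - fls_const w * e (- s) = 0" using * assms by simp
    with * have "fls_const z * e s = 0" by (simp add: add_eq_0_iff)
    hence "z = 0" using nz by simp
    with * show ?thesis using ee by auto
  qed
  ultimately show ?thesis
    unfolding e_def[symmetric] using eH
    by (intro picard_vessiot_complex_functions[of _ "e s" "e (- s)"])
      (simp_all add: De power2_eq_square flip: mult.assoc)
qed

text \<open>The two Laurent series models show that Picard-Vessiot extensions exist. The group is
  computed for an arbitrary one, where y is characterized by its first order equation; this fixes it
  only up to an additive or a nonzero multiplicative constant.\<close>

theorem proposition5p1:
  fixes a b c \<rho> s :: complex
    and L :: "('l, 'm) ring_scheme" and D :: "'l \<Rightarrow> 'l" and \<iota> :: "complex \<Rightarrow> 'l"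
  assumes rho: "\<rho> = 2 * a * b - c"
    and sqrt_rho: "s ^ 2 = \<rho>"
  shows
    "(\<forall>x u. (\<forall>t. x t = exp ((a + b) * t) * u t) \<longrightarrow>
        (\<exists>y. system_solution a b c x y) = reduced_solution \<rho> u) \<and>
     (2 * a * b - c = 0 \<longrightarrow>
        picard_vessiot complex_field (\<lambda>_. 0) (complex_functions fls_X) fls_deriv fls_const \<rho>) \<and>
     (2 * a * b - c \<noteq> 0 \<longrightarrow>
        picard_vessiot complex_field (\<lambda>_. 0) (complex_functions (fps_to_fls (fps_exp s)))
          fls_deriv fls_const \<rho>) \<and>
     (picard_vessiot complex_field (\<lambda>_. 0) L D \<iota> \<rho> \<longrightarrow>
        (2 * a * b - c = 0 \<longrightarrow>
           (\<exists>y\<in>carrier L. D y = \<one>\<^bsub>L\<^esub>) \<and>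
           (\<forall>y\<in>carrier L. D y = \<one>\<^bsub>L\<^esub> \<longrightarrow>
              carrier L = simple_extension complex_field L \<iota> y \<and>
              (\<exists>\<sigma>. (\<forall>\<mu>. \<sigma> \<mu> y = y \<oplus>\<^bsub>L\<^esub> \<iota> \<mu>) \<and>
                   carrier (DGal complex_field L D \<iota>) = {\<sigma> \<mu> | \<mu>. True} \<and>
                   \<sigma> \<in> iso (add_monoid complex_field) (DGal complex_field L D \<iota>)))) \<and>
        (2 * a * b - c \<noteq> 0 \<longrightarrow>
           (\<exists>y\<in>carrier L. y \<noteq> \<zero>\<^bsub>L\<^esub> \<and> D y = \<iota> s \<otimes>\<^bsub>L\<^esub> y) \<and>
           (\<forall>y\<in>carrier L. y \<noteq> \<zero>\<^bsub>L\<^esub> \<and> D y = \<iota> s \<otimes>\<^bsub>L\<^esub> y \<longrightarrow>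
              carrier L = simple_extension complex_field L \<iota> y \<and>
              (\<exists>\<sigma>. (\<forall>\<mu>. \<mu> \<noteq> 0 \<longrightarrow> \<sigma> \<mu> y = \<iota> \<mu> \<otimes>\<^bsub>L\<^esub> y) \<and>
                   carrier (DGal complex_field L D \<iota>) = {\<sigma> \<mu> | \<mu>. \<mu> \<noteq> 0} \<and>
                   \<sigma> \<in> iso (units_of complex_field) (DGal complex_field L D \<iota>)))))"
  (is "?change \<and> ?model_add \<and> ?model_mult \<and> (?PV \<longrightarrow> ?Gal_add \<and> ?Gal_mult)")
proof (intro conjI)
  show ?change using ex_system_solution_iff rho by blast
  show ?model_add using picard_vessiot_fls_X rho by simp
  \<comment> \<open>For s = 0 also \<rho> = 0, and the claim is vacuous.\<close>
  show ?model_mult using picard_vessiot_fls_exp[of s] sqrt_rho rho by (cases "s = 0") simp_all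
  show "?PV \<longrightarrow> ?Gal_add \<and> ?Gal_mult"
  proof
    assume ?PV
    then obtain y1 y2 where pv: "constant_picard_vessiot L D \<iota> \<rho> y1 y2"
      by (rule picard_vessiot_imp)
    note facts = constant_picard_vessiot.ex_additive[OF pv]
      constant_picard_vessiot.carrier_eq_gen_additive[OF pv]
      constant_picard_vessiot.Gal_additive[OF pv]
      constant_picard_vessiot.ex_multiplicative[OF pv sqrt_rho]
      constant_picard_vessiot.carrier_eq_gen_multiplicative[OF pv sqrt_rho]
      constant_picard_vessiot.Gal_multiplicative[OF pv sqrt_rho]
    have ext: "simple_extension complex_field L \<iota> y = generate_field L (insert y (range \<iota>))" for y
      by (simp add: simple_extension_def)
    have img: "{\<sigma> \<mu> | \<mu>. True} = range \<sigma>" "{\<sigma> \<mu> | \<mu>. \<mu> \<noteq> 0} = \<sigma> ` {\<mu>. \<mu> \<noteq> 0}"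
      for \<sigma> :: "complex \<Rightarrow> 'l \<Rightarrow> 'l" by auto
    \<comment> \<open>Translates the case distinction on \<rho> into the condition on s that the
      eigenvalue lemmas require.\<close>
    have s: "s = 0 \<longleftrightarrow> \<rho> = 0" using sqrt_rho by auto
    show "?Gal_add \<and> ?Gal_mult"
      unfolding ext img rho[symmetric]
      by (intro conjI impI ballI; (elim conjE)?; rule facts; simp add: s)
  qed
qed

end
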